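(* Let $T$ be a polyhedral tessellation of $\mathbb{R}^n$ and let $T^1$ be a scaled-down copy of $T$. If $\chi(T)$ is refinable with respect to $T^1$, that is, if each indicator function in $\chi(T)$ is a linear combination of indicator functions in $\chi(T^1)$, then every facet of (a cell of) $T$ is the union of facets of (cells of) $T^1$.
   Context: A polyhedral tessellation $T$ of $\mathbb{R}^n$ is a partition of $\mathbb{R}^n$ into unpartitioned $n$-dimensional polyhedral units, called cells, each bounded by a finite number of $(n-1)$-dimensional facets; cells cover $\mathbb{R}^n$ and have no $n$-dimensional overlap (cells may be taken half-open so that they do not overlap on facets; equalities of functions below are meant up to values on cell boundaries). The facets of $T$ are the facets of its cells. The indicator function of a cell is $1$ on the cell and $0$ elsewhere; $\chi(T)$ denotes the collection of indicator functions of the cells of $T$. A scaled-down copy of $T$ is a tessellation $T^1=\lambda T+v$ with $0<\lambda<1$, $v\in\mathbb{R}^n$ (for example $\tfrac12 T$). Linear combinations may involve infinitely many cells; the sums are locally finite. *)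

theory Defs
  imports "HOL-Analysis.Analysis"
begin

text \<open>Cells are represented by closed convex polyhedra of full dimension. Passing to half-open cells
  would only change indicator functions on cell boundaries, which are disregarded below.
  Local finiteness is not part of this definition; it is required of the linear combinations.\<close>

definition polyhedral_tessellation :: "'a::euclidean_space set set \<Rightarrow> bool" where
  "polyhedral_tessellation T \<longleftrightarrow>
     (\<forall>C\<in>T. polyhedron C \<and> aff_dim C = int DIM('a)) \<and>
     \<Union>T = UNIV \<and>
     pairwise (\<lambda>C D. interior (C \<inter> D) = {}) T"

definition facets :: "'a::euclidean_space set set \<Rightarrow> 'a set set" where
  "facets T = {F. \<exists>C\<in>T. F facet_of C}"

definition boundaries :: "'a::euclidean_space set set \<Rightarrow> 'a set" where
  "boundaries T = (\<Union>C\<in>T. frontier C)"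

definition scaled_copy :: "real \<Rightarrow> 'a::euclidean_space \<Rightarrow> 'a set set \<Rightarrow> 'a set set" where
  "scaled_copy r v T = (\<lambda>C. (\<lambda>x. r *\<^sub>R x + v) ` C) ` T"

definition chi :: "'a::euclidean_space set set \<Rightarrow> ('a \<Rightarrow> real) set" where
  "chi T = (\<lambda>C. indicator C) ` T"

text \<open>The coefficients \<open>c\<close> may be nonzero for infinitely many members of \<open>G\<close>, but near each
  point only finitely many terms \<open>c g * g\<close> are not identically zero.\<close>

definition locally_finite_combination ::
  "('a::euclidean_space \<Rightarrow> real) set \<Rightarrow> (('a \<Rightarrow> real) \<Rightarrow> real) \<Rightarrow> bool" where
  "locally_finite_combination G c \<longleftrightarrow>
     (\<forall>x. \<exists>e>0. finite {g \<in> G. \<exists>y\<in>ball x e. c g * g y \<noteq> 0})"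

text \<open>The linear combination is required to agree with \<open>f\<close> off the cell boundaries.\<close>

definition refinable :: "'a::euclidean_space set set \<Rightarrow> 'a set set \<Rightarrow> bool" where
  "refinable T T1 \<longleftrightarrow>
     (\<forall>f\<in>chi T. \<exists>c. locally_finite_combination (chi T1) c \<and>
        (\<forall>x. x \<notin> boundaries T \<union> boundaries T1 \<longrightarrow>
           ((\<lambda>g. c g * g x) has_sum f x) (chi T1)))"

end

theory Submission
  imports Defs
begin

text \<open>Away from the null set of all cell boundaries, a combination of indicators of \<open>T1\<close>-cells
  equals a single coefficient on each cell. Hence, writing the indicator of a cell \<open>C\<close> of \<open>T\<close> as such a
  combination, the \<open>T1\<close>-cells with coefficient \<open>1\<close> form a locally finite subdivision of \<open>C\<close>.
  They cut a facet \<open>F\<close> of \<open>C\<close> into faces \<open>F \<inter> D\<close>; finitely many of these of smaller dimension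
  cannot cover a relatively open piece of \<open>F\<close>, so those of the dimension of \<open>F\<close> already cover \<open>F\<close>.\<close>

section \<open>Affine images of tessellations\<close>

lemma polyhedron_translation:
  fixes S :: "'a::euclidean_space set"
  assumes "polyhedron S"
  shows "polyhedron ((+) v ` S)"
proof -
  obtain \<H> where \<H>: "finite \<H>" "S = \<Inter>\<H>" "\<And>h. h \<in> \<H> \<Longrightarrow> \<exists>a b. a \<noteq> 0 \<and> h = {x. a \<bullet> x \<le> b}"
    using assms unfolding polyhedron_def by blast
  \<comment> \<open>A bijection commutes with intersections; surjectivity covers the case of an
    empty \<open>\<H>\<close>.\<close>
  have "(+) v ` S = \<Inter>((`) ((+) v) ` \<H>)"
    unfolding \<H>(2) using bij_image_INT[of "(+) v" "\<lambda>x. x" \<H>] by (simp add: bij_plus)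
  moreover have "\<exists>a b. a \<noteq> 0 \<and> (+) v ` h = {x. a \<bullet> x \<le> b}" if "h \<in> \<H>" for h
  proof -
    obtain a b where ab: "a \<noteq> 0" "h = {x. a \<bullet> x \<le> b}"
      using \<H>(3) \<open>h \<in> \<H>\<close> by blast
    have "(+) v ` h = {x. a \<bullet> x \<le> b + a \<bullet> v}"
    proof (intro set_eqI iffI)
      fix x assume "x \<in> {x. a \<bullet> x \<le> b + a \<bullet> v}"
      then show "x \<in> (+) v ` h"
        unfolding ab by (intro image_eqI[of _ _ "x - v"]) (auto simp: inner_diff_right)
    qed (auto simp: ab inner_add_right)
    then show ?thesis
      using ab by blast
  qed
  ultimately show ?thesis
    unfolding polyhedron_def using \<H>(1) by (intro exI[of _ "(`) ((+) v) ` \<H>"]) auto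
qed

text \<open>This lets the facts about cells be applied to \<open>T1\<close> as well. The affine map
  splits into a linear bijection and a translation, each preserving polyhedra, dimension and
  interiors.\<close>

lemma polyhedral_tessellation_scaled_copy:
  fixes T :: "'a::euclidean_space set set"
  assumes T: "polyhedral_tessellation T" and "r \<noteq> 0"
  shows "polyhedral_tessellation (scaled_copy r v T)"
proof -
  define f :: "'a \<Rightarrow> 'a" where "f = (\<lambda>x. r *\<^sub>R x + v)"
  define s :: "'a \<Rightarrow> 'a" where "s = (\<lambda>x. r *\<^sub>R x)"
  have s: "linear s" "inj s" "bij s"
    using \<open>r \<noteq> 0\<close> linear_injective_imp_surjective[of s]
    by (auto simp: s_def inj_on_def bij_def linear_iff scaleR_add_right)
  have f: "f = (+) v \<circ> s"
    by (auto simp: f_def s_def)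
  have "bij f"
    unfolding f using s by (simp add: bij_comp bij_plus)
  have im: "f ` C = (+) v ` s ` C" for C
    by (simp add: f image_comp)
  have poly: "polyhedron (f ` C)" if "polyhedron C" for C
    using that s by (simp add: im polyhedron_translation polyhedron_linear_image_eq)
  have dim: "aff_dim (f ` C) = aff_dim C" for C
    using s by (simp add: im aff_dim_translation_eq)
  have cover: "\<Union>((`) f ` T) = UNIV"
    using T \<open>bij f\<close> unfolding polyhedral_tessellation_def bij_def by (metis image_Union)
  have "interior (f ` C) = f ` interior C" for C
    using s by (simp add: im interior_translation interior_injective_linear_image)
  moreover have "f ` C \<inter> f ` D = f ` (C \<inter> D)" for C D
    using \<open>bij f\<close> by (simp add: bij_def image_Int)
  ultimately have int: "interior (f ` C \<inter> f ` D) = f ` interior (C \<inter> D)" for C D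
    by metis
  have "pairwise (\<lambda>C D. interior (C \<inter> D) = {}) ((`) f ` T)"
  proof (rule pairwise_imageI)
    fix C D assume "C \<in> T" "D \<in> T" "C \<noteq> D"
    then have "interior (C \<inter> D) = {}"
      using T unfolding polyhedral_tessellation_def pairwise_def by blast
    then show "interior (f ` C \<inter> f ` D) = {}"
      unfolding int by simp
  qed
  then show ?thesis
    using T poly dim cover
    unfolding polyhedral_tessellation_def scaled_copy_def f_def[symmetric] by simp
qed

section \<open>Cells, their interiors and their boundaries\<close>

lemma tessellation_cell:
  assumes "polyhedral_tessellation T" "C \<in> T"
  shows "convex C" "closed C" "interior C \<noteq> {}" "closure (interior C) = C"
proof -
  have C: "polyhedron C" "aff_dim C = int DIM('a)"
    using assms by (auto simp: polyhedral_tessellation_def)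
  show "convex C" "closed C"
    using C by (auto simp: polyhedron_imp_convex polyhedron_imp_closed)
  show "interior C \<noteq> {}"
    using C(2) \<open>convex C\<close> rel_interior_eq_empty[of C] interior_rel_interior_gen[of C] by force
  then show "closure (interior C) = C"
    using \<open>convex C\<close> \<open>closed C\<close> by (simp add: convex_closure_interior)
qed

text \<open>An open set disjoint from \<open>interior D\<close> also misses its closure, which is
  all of \<open>D\<close>.\<close>

lemma tessellation_unique_cell:
  assumes T: "polyhedral_tessellation T" and "C \<in> T" "D \<in> T" "x \<in> interior C" "x \<in> D"
  shows "D = C"
proof (rule ccontr)
  assume "D \<noteq> C"
  then have "interior C \<inter> interior D = {}"
    using T \<open>C \<in> T\<close> \<open>D \<in> T\<close> by (force simp: polyhedral_tessellation_def pairwise_def)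
  then have "interior C \<inter> closure (interior D) = {}"
    by (simp add: open_Int_closure_eq_empty)
  then show False
    using tessellation_cell(4)[OF T \<open>D \<in> T\<close>] assms by blast
qed

text \<open>Disjoint open interiors are countable in number, and a cell is recovered from its
  interior by closure, so \<open>T\<close> is countable. Each convex frontier is a null set.\<close>

lemma negligible_boundaries:
  assumes T: "polyhedral_tessellation T"
  shows "negligible (boundaries T)"
proof -
  have "inj_on interior T"
  proof (rule inj_onI)
    fix C D assume "C \<in> T" "D \<in> T" "interior C = interior D"
    then show "C = D"
      using tessellation_cell(4)[OF T] by metis
  qed
  moreover have "countable (interior ` T)"
  proof (rule countable_disjoint_open_subsets)
    show "pairwise disjnt (interior ` T)"
    proof (rule pairwise_imageI)
      fix C D assume "C \<in> T" "D \<in> T" "C \<noteq> D"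
      then show "disjnt (interior C) (interior D)"
        using T by (simp add: polyhedral_tessellation_def pairwise_def disjnt_def)
    qed
  qed auto
  ultimately have "countable T"
    using countable_image_inj_on by blast
  then show ?thesis
    unfolding boundaries_def
    using tessellation_cell(1)[OF T] negligible_convex_frontier
    by (intro negligible_countable_Union) auto
qed

section \<open>Null sets, closures and coverings by dimension\<close>

lemma open_subset_closure_Diff_negligible:
  assumes "open U" "negligible N"
  shows "U \<subseteq> closure (U - N)"
proof -
  \<comment> \<open>The part of \<open>U\<close> missed by the closure is open and null, hence
    empty.\<close>
  have "U - closure (U - N) \<subseteq> N"
    using closure_subset by blast
  then have "negligible (U - closure (U - N))"
    using \<open>negligible N\<close> negligible_subset by blast
  moreover have "open (U - closure (U - N))"
    using \<open>open U\<close> by (simp add: open_Diff)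
  ultimately have "U - closure (U - N) = {}"
    using open_not_negligible by blast
  then show ?thesis
    by blast
qed

text \<open>One closed set \<open>D\<close> of smaller dimension cannot contain \<open>S\<close>.
  Near a point of \<open>S\<close> off \<open>D\<close>, a convex piece of \<open>S\<close> of the
  same dimension avoids \<open>D\<close>, and induction applies to that piece; hence
  \<open>S\<close> is arbitrary in the induction.\<close>

lemma convex_not_covered_by_lowdim:
  fixes S :: "'a::euclidean_space set"
  assumes "finite \<D>" "convex S" "S \<noteq> {}"
    and "\<And>D. D \<in> \<D> \<Longrightarrow> closed D \<and> aff_dim D < aff_dim S"
  shows "\<not> S \<subseteq> \<Union>\<D>"
  using assms
proof (induction \<D> arbitrary: S rule: finite_induct)
  case empty
  then show ?case by simp
next
  case (insert D \<D>)
  have "\<not> S \<subseteq> D"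
    using insert.prems(3)[of D] aff_dim_subset[of S D] by auto
  then have "S \<inter> - D \<noteq> {}" "open (- D)"
    using insert.prems(3)[of D] by auto
  then have "aff_dim (S \<inter> - D) = aff_dim S"
    using aff_dim_convex_Int_open \<open>convex S\<close> by blast
  obtain x where x: "x \<in> S" "x \<notin> D"
    using \<open>\<not> S \<subseteq> D\<close> by blast
  then obtain e where e: "e > 0" "ball x e \<subseteq> - D"
    using \<open>open (- D)\<close> open_contains_ball by blast
  have "S \<inter> ball x e \<noteq> {}"
    using x e by auto
  moreover from this have "aff_dim (S \<inter> ball x e) = aff_dim S"
    using aff_dim_convex_Int_open[OF \<open>convex S\<close>] by blast
  ultimately have "\<not> S \<inter> ball x e \<subseteq> \<Union>\<D>"
    using insert.prems by (intro insert.IH) (auto intro: convex_Int)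
  then show ?case
    using e by blast
qed

text \<open>A point of \<open>S\<close> outside the closed union of the high-dimensional members
  would have a neighbourhood where finitely many low-dimensional members cover \<open>S\<close>,
  which \<open>convex_not_covered_by_lowdim\<close> excludes.\<close>

lemma convex_covered_by_fulldim:
  fixes S :: "'a::euclidean_space set"
  assumes "convex S" "S \<subseteq> \<Union>\<D>" and lf: "locally_finite_in euclidean \<D>"
    and clo: "\<And>D. D \<in> \<D> \<Longrightarrow> closed D"
  shows "S \<subseteq> \<Union>{D \<in> \<D>. aff_dim S \<le> aff_dim D}"
proof
  let ?L = "{D \<in> \<D>. aff_dim S \<le> aff_dim D}"
  fix x assume "x \<in> S"
  show "x \<in> \<Union>?L"
  proof (rule ccontr)
    assume "x \<notin> \<Union>?L"
    moreover have "closed (\<Union>?L)"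
      using closedin_locally_finite_Union[of ?L euclidean] lf clo locally_finite_in_subset[of euclidean \<D> ?L]
      by auto
    moreover obtain V where V: "open V" "x \<in> V" "finite {D \<in> \<D>. D \<inter> V \<noteq> {}}"
      using lf unfolding locally_finite_in_def by auto
    ultimately have "open (V - \<Union>?L)" "x \<in> V - \<Union>?L"
      by (simp_all add: open_Diff)
    then obtain e where e: "e > 0" "ball x e \<subseteq> V - \<Union>?L"
      unfolding open_contains_ball by blast
    define \<E> where "\<E> = {D \<in> \<D>. D \<inter> V \<noteq> {}} - ?L"
    have ne: "S \<inter> ball x e \<noteq> {}"
      using \<open>x \<in> S\<close> e by auto
    then have "aff_dim (S \<inter> ball x e) = aff_dim S"
      using aff_dim_convex_Int_open[OF \<open>convex S\<close>] by blast
    then have "\<not> S \<inter> ball x e \<subseteq> \<Union>\<E>"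
      using V(3) clo ne \<open>convex S\<close> by (intro convex_not_covered_by_lowdim) (auto simp: \<E>_def convex_Int)
    then obtain y where y: "y \<in> S" "y \<in> ball x e" "y \<notin> \<Union>\<E>"
      by blast
    obtain D where "D \<in> \<D>" "y \<in> D"
      using \<open>S \<subseteq> \<Union>\<D>\<close> y(1) by blast
    moreover have "y \<in> V" "y \<notin> \<Union>?L"
      using y(2) e(2) by blast+
    ultimately show False
      using y(3) unfolding \<E>_def by blast
  qed
qed

section \<open>From refinability to a subdivision of each cell\<close>

lemma refinable_imp_subdivision:
  assumes T: "polyhedral_tessellation T" and T1: "polyhedral_tessellation T1"
    and ref: "refinable T T1" and "C \<in> T"
  obtains \<D> where "\<D> \<subseteq> T1" "locally_finite_in euclidean \<D>" "C = \<Union>\<D>"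
proof -
  define N where "N = boundaries T \<union> boundaries T1"
  have N: "negligible N"
    unfolding N_def using T T1 by (simp add: negligible_boundaries)
  have "indicator C \<in> chi T"
    using \<open>C \<in> T\<close> by (auto simp: chi_def)
  then obtain c where lf: "locally_finite_combination (chi T1) c"
    and sum: "\<And>x. x \<notin> N \<Longrightarrow> ((\<lambda>g. c g * g x) has_sum indicator C x) (chi T1)"
    using ref unfolding refinable_def N_def by blast
  \<comment> \<open>The other indicators vanish at \<open>x\<close>, so the sum has a single term.
    Its value does not depend on \<open>x\<close>, so \<open>C\<close> contains all or none of
    \<open>interior D - N\<close>.\<close>
  have coeff: "c (indicator D) = indicator C x" if "D \<in> T1" "x \<in> interior D" "x \<notin> N" for D x
  proof -
    have "g x = 0" if "g \<in> chi T1 - {indicator D}" for g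
    proof -
      obtain E where "E \<in> T1" "g = indicator E" "E \<noteq> D"
        using \<open>g \<in> chi T1 - {indicator D}\<close> unfolding chi_def by blast
      then show ?thesis
        using tessellation_unique_cell[OF T1 \<open>D \<in> T1\<close> _ \<open>x \<in> interior D\<close>] by (auto simp: indicator_def)
    qed
    moreover have "indicator D \<in> chi T1" "x \<in> D"
      using that interior_subset by (auto simp: chi_def)
    ultimately have "((\<lambda>g. c g * g x) has_sum c (indicator D)) (chi T1)"
      by (intro has_sum_finite_neutralI[of "{indicator D}"]) auto
    then show ?thesis
      using sum[OF \<open>x \<notin> N\<close>] has_sum_unique by blast
  qed
  define \<D> where "\<D> = {D \<in> T1. c (indicator D) = 1}"
  have lfD: "locally_finite_in euclidean \<D>"
    unfolding locally_finite_in_def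
  proof (intro conjI ballI)
    fix x :: 'a
    obtain e where e: "e > 0" "finite {g \<in> chi T1. \<exists>y\<in>ball x e. c g * g y \<noteq> 0}"
      using lf unfolding locally_finite_combination_def by blast
    have "indicator D \<in> {g \<in> chi T1. \<exists>y\<in>ball x e. c g * g y \<noteq> 0}"
      if "D \<in> \<D>" "D \<inter> ball x e \<noteq> {}" for D
      using that unfolding \<D>_def chi_def by (auto simp: indicator_def)
    then have "(\<lambda>D. indicator D :: 'a \<Rightarrow> real) ` {D \<in> \<D>. D \<inter> ball x e \<noteq> {}}
        \<subseteq> {g \<in> chi T1. \<exists>y\<in>ball x e. c g * g y \<noteq> 0}"
      by blast
    \<comment> \<open>Local finiteness is given for indicator functions; injectivity carries it over
      to cells.\<close>
    moreover have "inj (\<lambda>D. indicator D :: 'a \<Rightarrow> real)"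
    proof (rule injI)
      fix A B :: "'a set" assume "(indicator A :: 'a \<Rightarrow> real) = indicator B"
      then show "A = B"
        by (metis (no_types, lifting) indicator_eq_1_iff subsetI subset_antisym)
    qed
    ultimately have "finite {D \<in> \<D>. D \<inter> ball x e \<noteq> {}}"
      using e(2) by (meson finite_subset finite_imageD inj_on_subset subset_UNIV)
    then show "\<exists>V. openin euclidean V \<and> x \<in> V \<and> finite {U \<in> \<D>. U \<inter> V \<noteq> {}}"
      using e(1) by (intro exI[of _ "ball x e"]) auto
  qed auto
  have "D \<subseteq> C" if "D \<in> \<D>" for D
  proof -
    have "D \<in> T1" "c (indicator D) = 1"
      using that by (auto simp: \<D>_def)
    then have "interior D - N \<subseteq> C"
      using coeff[OF \<open>D \<in> T1\<close>] by (fastforce simp: indicator_def split: if_splits)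
    \<comment> \<open>Two closures in the closed set \<open>C\<close>: the first restores the points
      of \<open>N\<close>, the second the frontier of \<open>D\<close>.\<close>
    then have "interior D \<subseteq> C"
      using open_subset_closure_Diff_negligible[OF open_interior N] closure_minimal
        tessellation_cell(2)[OF T \<open>C \<in> T\<close>] by blast
    then show ?thesis
      using tessellation_cell(4)[OF T1 \<open>D \<in> T1\<close>] closure_minimal
        tessellation_cell(2)[OF T \<open>C \<in> T\<close>] by blast
  qed
  moreover have "C \<subseteq> \<Union>\<D>"
  proof -
    have "interior C - N \<subseteq> \<Union>\<D>"
    proof
      fix x assume x: "x \<in> interior C - N"
      obtain D where D: "D \<in> T1" "x \<in> D"
        using T1 unfolding polyhedral_tessellation_def by blast
      have "x \<notin> frontier D"
        using x D(1) by (auto simp: N_def boundaries_def)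
      then have "x \<in> interior D"
        using D(2) closure_subset by (auto simp: frontier_def)
      then show "x \<in> \<Union>\<D>"
        using coeff[OF D(1)] x D interior_subset by (fastforce simp: \<D>_def)
    qed
    \<comment> \<open>Local finiteness makes the union closed, so the inclusion off \<open>N\<close>
      extends to all of \<open>C\<close>.\<close>
    moreover have "closed (\<Union>\<D>)"
      using closedin_locally_finite_Union[OF _ lfD] tessellation_cell(2)[OF T1]
      by (auto simp: \<D>_def)
    ultimately have "interior C \<subseteq> \<Union>\<D>"
      using open_subset_closure_Diff_negligible[OF open_interior N] closure_minimal by blast
    then show ?thesis
      using tessellation_cell(4)[OF T \<open>C \<in> T\<close>] closure_minimal \<open>closed (\<Union>\<D>)\<close> by blast
  qed
  ultimately show ?thesis
    using that[of \<D>] lfD by (auto simp: \<D>_def)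
qed

section \<open>Traces of the subdivision on a facet\<close>

theorem proposition1:
  fixes T T1 :: "'a::euclidean_space set set" and r :: real and v :: 'a
  assumes "polyhedral_tessellation T"
    and "0 < r" and "r < 1" and "T1 = scaled_copy r v T"
    and "refinable T T1"
  shows "\<forall>F\<in>facets T. \<exists>\<G>\<subseteq>facets T1. F = \<Union>\<G>"
proof
  fix F assume "F \<in> facets T"
  then obtain C where C: "C \<in> T" "F facet_of C"
    unfolding facets_def by blast
  have T1: "polyhedral_tessellation T1"
    using assms by (simp add: polyhedral_tessellation_scaled_copy)
  obtain \<D> where \<D>: "\<D> \<subseteq> T1" "locally_finite_in euclidean \<D>" "C = \<Union>\<D>"
    using refinable_imp_subdivision[OF assms(1) T1 assms(5) C(1)] .
  have F: "F face_of C" "F \<noteq> {}" "aff_dim F = aff_dim C - 1"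
    using C(2) by (auto simp: facet_of_def)
  have "aff_dim C = int DIM('a)"
    using assms(1) C(1) by (auto simp: polyhedral_tessellation_def)
  have cl: "convex F" "closed F" "F \<subseteq> C"
    using F(1) tessellation_cell[OF assms(1) C(1)] face_of_imp_convex face_of_imp_closed face_of_imp_subset
    by blast+
  define \<E> where "\<E> = (\<inter>) F ` \<D>"
  \<comment> \<open>Traces of lower dimension occur where a cell only touches \<open>F\<close>; they
    are dropped because they cannot be facets.\<close>
  define \<G> where "\<G> = {E \<in> \<E>. aff_dim F \<le> aff_dim E}"
  have "locally_finite_in euclidean \<E>"
    unfolding \<E>_def by (rule locally_finite_in_refinement[OF \<D>(2)]) auto
  moreover have "closed E" if "E \<in> \<E>" for E
    using that \<D>(1) cl tessellation_cell(2)[OF T1] by (auto simp: \<E>_def)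
  moreover have "F \<subseteq> \<Union>\<E>"
    using cl(3) \<D>(3) by (auto simp: \<E>_def)
  ultimately have "F \<subseteq> \<Union>\<G>"
    unfolding \<G>_def using cl(1) by (intro convex_covered_by_fulldim)
  moreover have "\<Union>\<G> \<subseteq> F"
    by (auto simp: \<G>_def \<E>_def)
  moreover have "\<G> \<subseteq> facets T1"
  proof
    fix G assume "G \<in> \<G>"
    then obtain D where D: "D \<in> \<D>" "G = F \<inter> D" "aff_dim F \<le> aff_dim G"
      by (auto simp: \<G>_def \<E>_def)
    then have "D \<in> T1" "D \<subseteq> C"
      using \<D> by auto
    have "aff_dim D = int DIM('a)"
      using T1 \<open>D \<in> T1\<close> by (auto simp: polyhedral_tessellation_def)
    \<comment> \<open>Slicing the face \<open>F\<close> of \<open>C\<close> by the convex set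
      \<open>D\<close> gives a face of \<open>C \<inter> D\<close>, which is
      \<open>D\<close>.\<close>
    have "G face_of D"
      using face_of_slice[OF F(1), of D] tessellation_cell(1)[OF T1 \<open>D \<in> T1\<close>] \<open>D \<subseteq> C\<close> D(2)
      by (simp add: Int_absorb1)
    moreover have "aff_dim G = aff_dim F"
      using D(2,3) aff_dim_subset[of G F] by auto
    \<comment> \<open>Only the empty set has affine dimension -1, and \<open>F\<close> is
      nonempty.\<close>
    moreover have "G \<noteq> {}"
      using \<open>aff_dim G = aff_dim F\<close> F(2) by (metis aff_dim_empty)
    ultimately have "G facet_of D"
      using F(3) \<open>aff_dim C = int DIM('a)\<close> \<open>aff_dim D = int DIM('a)\<close> by (simp add: facet_of_def)
    then show "G \<in> facets T1"
      using \<open>D \<in> T1\<close> by (auto simp: facets_def)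
  qed
  ultimately show "\<exists>\<G>\<subseteq>facets T1. F = \<Union>\<G>"
    by blast
qed

end
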